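(* Let $\mathbb{K} = \mathbb{R}$ or $\mathbb{K} = \mathbb{C}$, let $V$ be a finite-dimensional $\mathbb{K}$-vector space, and let $\mathcal{T}_r V$ denote the vector space of $r$-times covariant tensors over $V$. For every algebraic curvature tensor $T \in \mathcal{T}_4 V$ there exist a finite set $\mathcal{S}$ of symmetric tensors $S \in \mathcal{T}_2 V$ and a finite set $\mathcal{A}$ of alternating (skew-symmetric) tensors $A \in \mathcal{T}_2 V$, together with signs $\epsilon_S \in \{1,-1\}$ for $S\in\mathcal{S}$ and $\epsilon_A \in \{1,-1\}$ for $A \in \mathcal{A}$, such that $$T = \sum_{S \in \mathcal{S}} \epsilon_S\, \gamma(S) + \sum_{A \in \mathcal{A}} \epsilon_A\, \alpha(A).$$
   Context: An element of $\mathcal{T}_r V$ is an $r$-linear map $V^r \to \mathbb{K}$. A tensor $T \in \mathcal{T}_4 V$ is called an algebraic curvature tensor iff for all $u,x,y,z \in V$: $T(u,x,y,z) = -T(u,x,z,y) = T(y,z,u,x)$ and $T(u,x,y,z) + T(u,y,z,x) + T(u,z,x,y) = 0$. Equivalently, its coordinates with respect to every basis satisfy $T_{ijkl} = -T_{jikl} = -T_{ijlk} = T_{klij}$ and $T_{ijkl}+T_{iklj}+T_{iljk}=0$. For a symmetric tensor $S \in \mathcal{T}_2 V$ (coordinates $S_{ij}=S_{ji}$), the tensor $\gamma(S)\in\mathcal{T}_4 V$ is defined by $\gamma(S)_{ijkl} := \frac{1}{3}\left(S_{il}S_{jk} - S_{ik}S_{jl}\right)$. For a skew-symmetric (alternating)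 tensor $A \in \mathcal{T}_2 V$ (coordinates $A_{ji}=-A_{ij}$), the tensor $\alpha(A)\in\mathcal{T}_4 V$ is defined by $\alpha(A)_{ijkl} := \frac{1}{3}\left(2A_{ij}A_{kl} + A_{ik}A_{jl} - A_{il}A_{jk}\right)$. *)

theory Defs
  imports Complex_Main
begin

text \<open>
  A vector space is a type of class \<^class>\<open>ab_group_add\<close> with an explicit scalar multiplication
  \<open>scale\<close>, so that real and complex spaces are treated uniformly. Covariant tensors of
  order 2 and 4 are curried multilinear maps into the scalars (whose own scalar
  multiplication is \<open>(*)\<close>), and a coordinate \<open>T\<^sub>i\<^sub>j\<^sub>k\<^sub>l\<close> is the value \<open>T e\<^sub>i e\<^sub>j e\<^sub>k e\<^sub>l\<close>.
\<close>

definition tensor2 ::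
    "('k::field \<Rightarrow> 'v::ab_group_add \<Rightarrow> 'v) \<Rightarrow> ('v \<Rightarrow> 'v \<Rightarrow> 'k) \<Rightarrow> bool" where
  "tensor2 scale S \<longleftrightarrow>
     (\<forall>y. Vector_Spaces.linear scale (*) (\<lambda>x. S x y)) \<and>
     (\<forall>x. Vector_Spaces.linear scale (*) (\<lambda>y. S x y))"

definition tensor4 ::
    "('k::field \<Rightarrow> 'v::ab_group_add \<Rightarrow> 'v) \<Rightarrow> ('v \<Rightarrow> 'v \<Rightarrow> 'v \<Rightarrow> 'v \<Rightarrow> 'k) \<Rightarrow> bool" where
  "tensor4 scale T \<longleftrightarrow>
     (\<forall>x y z. Vector_Spaces.linear scale (*) (\<lambda>u. T u x y z)) \<and>
     (\<forall>u y z. Vector_Spaces.linear scale (*) (\<lambda>x. T u x y z)) \<and>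
     (\<forall>u x z. Vector_Spaces.linear scale (*) (\<lambda>y. T u x y z)) \<and>
     (\<forall>u x y. Vector_Spaces.linear scale (*) (\<lambda>z. T u x y z))"

definition symmetric_tensor ::
    "('k::field \<Rightarrow> 'v::ab_group_add \<Rightarrow> 'v) \<Rightarrow> ('v \<Rightarrow> 'v \<Rightarrow> 'k) \<Rightarrow> bool" where
  "symmetric_tensor scale S \<longleftrightarrow> tensor2 scale S \<and> (\<forall>x y. S x y = S y x)"

definition alternating_tensor ::
    "('k::field \<Rightarrow> 'v::ab_group_add \<Rightarrow> 'v) \<Rightarrow> ('v \<Rightarrow> 'v \<Rightarrow> 'k) \<Rightarrow> bool" where
  "alternating_tensor scale A \<longleftrightarrow> tensor2 scale A \<and> (\<forall>x y. A y x = - A x y)"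

definition algebraic_curvature_tensor ::
    "('k::field \<Rightarrow> 'v::ab_group_add \<Rightarrow> 'v) \<Rightarrow> ('v \<Rightarrow> 'v \<Rightarrow> 'v \<Rightarrow> 'v \<Rightarrow> 'k) \<Rightarrow> bool" where
  "algebraic_curvature_tensor scale T \<longleftrightarrow>
     tensor4 scale T \<and>
     (\<forall>u x y z. T u x y z = - T u x z y \<and>
                T u x y z = T y z u x \<and>
                T u x y z + T u y z x + T u z x y = 0)"

definition gamma_tensor :: "('v \<Rightarrow> 'v \<Rightarrow> 'k::field) \<Rightarrow> 'v \<Rightarrow> 'v \<Rightarrow> 'v \<Rightarrow> 'v \<Rightarrow> 'k" where
  "gamma_tensor S u x y z = 1/3 * (S u z * S x y - S u y * S x z)"

definition alpha_tensor :: "('v \<Rightarrow> 'v \<Rightarrow> 'k::field) \<Rightarrow> 'v \<Rightarrow> 'v \<Rightarrow> 'v \<Rightarrow> 'v \<Rightarrow> 'k" where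
  "alpha_tensor A u x y z = 1/3 * (2 * A u x * A y z + A u y * A x z - A u z * A x y)"

end

theory Submission imports Defs
begin

text \<open>
  The symmetric part of the decomposition is taken to be empty. For an alternating form \<open>A\<close>,
  the tensor \<open>\<alpha>(A)\<close> is \<open>A \<otimes> A\<close> minus one third of its cyclic sum over the last three arguments
  (lemma \<open>alpha_tensor_eq_Bianchi_projection\<close>). The linear map sending \<open>Q\<close> to \<open>Q\<close> minus one
  third of that cyclic sum fixes every algebraic curvature tensor \<open>T\<close>, by the first Bianchi
  identity. It is therefore enough to write \<open>T\<close> as a signed sum of squares \<open>A \<otimes> A\<close>;
  projecting such a decomposition gives one of \<open>T\<close> into tensors \<open>\<alpha>(A)\<close>.

  The symmetries of \<open>T\<close> say that it is a symmetric bilinear form on the second exterior power of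
  the space, so such a signed sum of squares exists by polarization. With coordinate functionals
  \<open>\<phi>\<^sub>c\<close> of a basis, put \<open>F\<^sub>c\<^sub>d = T(\<cdot>,\<cdot>,c,d)\<close> and \<open>E\<^sub>c\<^sub>d = \<phi>\<^sub>c \<and> \<phi>\<^sub>d\<close>. Expanding the last two
  arguments of \<open>T\<close> and using the exchange symmetry gives
  \<open>4T = \<Sum>\<^sub>c\<^sub>d (F\<^sub>c\<^sub>d \<otimes> E\<^sub>c\<^sub>d + E\<^sub>c\<^sub>d \<otimes> F\<^sub>c\<^sub>d)\<close>, and each summand is four times a
  difference of two squares (lemma \<open>curvature_tensor_eq_signed_sum_alpha\<close>).

  The decomposition so obtained is indexed by basis pairs and may repeat a tensor, whereas a set
  of tensors lists each one once. A repeated term either cancels or merges into a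
  single one, because \<open>2\<alpha>(A) = \<alpha>(\<surd>2 A)\<close> whenever 2 has a
  square root among the scalars (lemma \<open>signed_sum_over_set\<close>).
\<close>

section \<open>Signed sums without repetition\<close>

text \<open>
  Only an element already present with the same sign causes trouble. It is then removed, and
  an element \<open>b\<close> with twice its \<open>q\<close>-value is added instead; \<open>b\<close> may collide in turn, but
  with a smaller set, so the process ends.
\<close>
lemma signed_sum_add_term:
  fixes q :: "'a \<Rightarrow> 't \<Rightarrow> 'k::comm_ring_1"
  assumes double: "\<And>a. a \<in> C \<Longrightarrow> \<exists>b\<in>C. \<forall>t. q b t = 2 * q a t"
    and "finite X" "X \<subseteq> C" "\<forall>x\<in>X. \<epsilon> x \<in> {1, -1}" "a \<in> C" "e \<in> {1, -1}"
  shows "\<exists>Y \<delta>. finite Y \<and> Y \<subseteq> C \<and> (\<forall>y\<in>Y. \<delta> y \<in> {1, -1}) \<and>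
           (\<forall>t. (\<Sum>y\<in>Y. \<delta> y * q y t) = (\<Sum>x\<in>X. \<epsilon> x * q x t) + e * q a t)"
  using assms(2-)
proof (induction "card X" arbitrary: X a rule: less_induct)
  case less
  consider "a \<notin> X" | "a \<in> X" "\<epsilon> a = - e" | "a \<in> X" "\<epsilon> a = e"
    using less.prems by fastforce
  then show ?case
  proof cases
    case 1
    have "(\<Sum>x\<in>X. (\<epsilon>(a := e)) x * q x t) = (\<Sum>x\<in>X. \<epsilon> x * q x t)" for t
      using 1 by (intro sum.cong) auto
    then show ?thesis
      using 1 less.prems
      by (intro exI[of _ "insert a X"] exI[of _ "\<epsilon>(a := e)"]) auto
  next
    case 2
    then show ?thesis
      using less.prems
      by (intro exI[of _ "X - {a}"] exI[of _ \<epsilon>]) (auto simp: sum.remove[of X a])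
  next
    case 3
    obtain b where b: "b \<in> C" "\<And>t. q b t = 2 * q a t"
      using double less.prems(4) by blast
    have "card (X - {a}) < card X"
      using 3(1) less.prems(1) by (intro card_Diff1_less)
    then have "\<exists>Y \<delta>. finite Y \<and> Y \<subseteq> C \<and> (\<forall>y\<in>Y. \<delta> y \<in> {1, -1}) \<and>
        (\<forall>t. (\<Sum>y\<in>Y. \<delta> y * q y t) = (\<Sum>x\<in>X - {a}. \<epsilon> x * q x t) + e * q b t)"
      by (rule less.hyps) (use less.prems b(1) in auto)
    then obtain Y \<delta> where Y: "finite Y" "Y \<subseteq> C" "\<forall>y\<in>Y. \<delta> y \<in> {1, -1}"
      "\<And>t. (\<Sum>y\<in>Y. \<delta> y * q y t) = (\<Sum>x\<in>X - {a}. \<epsilon> x * q x t) + e * q b t"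
      by blast
    have "(\<Sum>y\<in>Y. \<delta> y * q y t) = (\<Sum>x\<in>X. \<epsilon> x * q x t) + e * q a t" for t
      using 3 less.prems(1) by (simp add: Y(4) b(2) sum.remove[of X a] algebra_simps)
    with Y(1-3) show ?thesis by blast
  qed
qed

lemma signed_sum_over_set:
  fixes q :: "'a \<Rightarrow> 't \<Rightarrow> 'k::comm_ring_1"
  assumes double: "\<And>a. a \<in> C \<Longrightarrow> \<exists>b\<in>C. \<forall>t. q b t = 2 * q a t"
    and "finite I" "\<And>i. i \<in> I \<Longrightarrow> f i \<in> C" "\<And>i. i \<in> I \<Longrightarrow> e i \<in> {1, -1}"
  shows "\<exists>X \<epsilon>. finite X \<and> X \<subseteq> C \<and> (\<forall>x\<in>X. \<epsilon> x \<in> {1, -1}) \<and>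
           (\<forall>t. (\<Sum>x\<in>X. \<epsilon> x * q x t) = (\<Sum>i\<in>I. e i * q (f i) t))"
  using assms(2-)
proof (induction I rule: finite_induct)
  case empty
  show ?case by (intro exI[of _ "{}"]) simp
next
  case (insert i I)
  then obtain X \<epsilon> where X: "finite X" "X \<subseteq> C" "\<forall>x\<in>X. \<epsilon> x \<in> {1, -1}"
    "\<And>t. (\<Sum>x\<in>X. \<epsilon> x * q x t) = (\<Sum>j\<in>I. e j * q (f j) t)"
    by auto
  from signed_sum_add_term[OF double X(1-3), of "f i" "e i"] insert.prems
  obtain Y \<delta> where "finite Y" "Y \<subseteq> C" "\<forall>y\<in>Y. \<delta> y \<in> {1, -1}"
    "\<And>t. (\<Sum>y\<in>Y. \<delta> y * q y t) = (\<Sum>x\<in>X. \<epsilon> x * q x t) + e i * q (f i) t"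
    by auto
  then show ?case
    using X(4) insert.hyps by (intro exI[of _ Y] exI[of _ \<delta>]) (simp add: add.commute)
qed

section \<open>Alternating tensors and the Bianchi projection\<close>

lemma vector_space_scalars: "vector_space ((*) :: 'k::field \<Rightarrow> 'k \<Rightarrow> 'k)"
  by unfold_locales (simp_all add: algebra_simps)

lemma alternating_tensor_iff:
  fixes scale :: "'k::field \<Rightarrow> 'v::ab_group_add \<Rightarrow> 'v"
  assumes "vector_space scale"
  shows "alternating_tensor scale A \<longleftrightarrow>
    (\<forall>x y. A y x = - A x y) \<and> (\<forall>x y z. A (x + y) z = A x z + A y z) \<and>
    (\<forall>c x y. A (scale c x) y = c * A x y)"
proof -
  \<comment> \<open>Linearity in the second argument follows from linearity in the first by antisymmetry.\<close>
  have "A z (x + y) = A z x + A z y"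
    if "\<forall>x y. A y x = - A x y" "\<forall>x y z. A (x + y) z = A x z + A y z" for x y z
    using that by (metis minus_add_distrib)
  moreover have "A x (scale c y) = c * A x y"
    if "\<forall>x y. A y x = - A x y" "\<forall>c x y. A (scale c x) y = c * A x y" for c x y
    using that by (metis mult_minus_right)
  ultimately show ?thesis
    using assms vector_space_scalars
    unfolding alternating_tensor_def tensor2_def Vector_Spaces.linear_iff by blast
qed

lemma alternating_tensor_add:
  assumes "vector_space scale" "alternating_tensor scale A" "alternating_tensor scale B"
  shows "alternating_tensor scale (\<lambda>x y. A x y + B x y)"
proof -
  have A: "A y x = - A x y" "A (x + y) z = A x z + A y z" "A (scale c x) y = c * A x y" for c x y z
    using assms(2) unfolding alternating_tensor_iff[OF assms(1)] by blast+
  have B: "B y x = - B x y" "B (x + y) z = B x z + B y z" "B (scale c x) y = c * B x y" for c x y z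
    using assms(3) unfolding alternating_tensor_iff[OF assms(1)] by blast+
  have anti: "A y x + B y x = - (A x y + B x y)" for x y
    by (subst A(1), subst B(1)) simp
  show ?thesis
    unfolding alternating_tensor_iff[OF assms(1)]
    by (intro conjI allI anti) (simp_all only: A(2,3) B(2,3) distrib_left add_ac)
qed

lemma alternating_tensor_scale:
  assumes "vector_space scale" "alternating_tensor scale A"
  shows "alternating_tensor scale (\<lambda>x y. c * A x y)"
proof -
  have A: "A y x = - A x y" "A (x + y) z = A x z + A y z" "A (scale d x) y = d * A x y" for d x y z
    using assms(2) unfolding alternating_tensor_iff[OF assms(1)] by blast+
  have anti: "c * A y x = - (c * A x y)" for x y
    by (subst A(1)) simp
  show ?thesis
    unfolding alternating_tensor_iff[OF assms(1)]
    by (intro conjI allI anti) (simp_all only: A(2,3) distrib_left mult_ac)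
qed

lemma alternating_tensor_wedge:
  assumes "Vector_Spaces.linear scale (*) f" "Vector_Spaces.linear scale (*) g"
  shows "alternating_tensor scale (\<lambda>x y. f x * g y - f y * g x)"
proof -
  have f: "vector_space scale" "f (x + y) = f x + f y" "f (scale c x) = c * f x"
    and g: "g (x + y) = g x + g y" "g (scale c x) = c * g x" for c x y
    using assms unfolding Vector_Spaces.linear_iff by blast+
  show ?thesis
    unfolding alternating_tensor_iff[OF f(1)] by (simp add: f(2,3) g algebra_simps)
qed

lemma alpha_tensor_scale: "alpha_tensor (\<lambda>x y. c * A x y) u x y z = c^2 * alpha_tensor A u x y z"
  unfolding alpha_tensor_def by (simp add: power2_eq_square algebra_simps)

text \<open>
  The shape in which \<open>\<alpha>(A)\<close> is used: it is linear in the tensor \<open>A \<otimes> A\<close>, and the three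
  terms are the ones that occur in the first Bianchi identity.
\<close>
lemma alpha_tensor_eq_Bianchi_projection:
  assumes "\<And>x y. A y x = - A x y"
  shows "alpha_tensor A u x y z =
    1/3 * (2 * (A u x * A y z) - A u y * A z x - A u z * A x y)"
  unfolding alpha_tensor_def by (simp add: assms[of x z] algebra_simps)

section \<open>Decomposition of curvature tensors\<close>

context finite_dimensional_vector_space
begin

lemma linear_representation:
  "Vector_Spaces.linear scale (*) (\<lambda>v. representation Basis v b)"
proof -
  have "representation Basis (x + y) b = representation Basis x b + representation Basis y b"
    and "representation Basis (scale c x) b = c * representation Basis x b" for x y c
    using representation_add[OF independent_Basis, of y x]
      representation_scale[OF independent_Basis, of x c]
    unfolding span_Basis by simp_all
  then show ?thesis
    unfolding Vector_Spaces.linear_iff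
    by (intro conjI allI vector_space_axioms vector_space_scalars)
qed

lemma linear_eq_sum_representation:
  assumes "Vector_Spaces.linear scale (*) f"
  shows "f v = (\<Sum>b\<in>Basis. representation Basis v b * f b)"
proof -
  interpret f: Vector_Spaces.linear scale "(*)" f by fact
  have "f v = f (\<Sum>b\<in>Basis. scale (representation Basis v b) b)"
    using sum_representation_eq[OF independent_Basis _ finite_Basis order_refl, of v]
    by (simp add: span_Basis)
  then show ?thesis by (simp add: f.sum f.scale)
qed

text \<open>
  Skew-symmetry in the last two arguments turns the products \<open>\<phi>\<^sub>c \<otimes> \<phi>\<^sub>d\<close> of coordinate functionals
  in the basis expansion of \<open>T\<close> into wedge products; the factor 2 comes from subtracting
  the expansions for the two orders of \<open>y\<close> and \<open>z\<close>.
\<close>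
lemma curvature_tensor_expansion:
  assumes "algebraic_curvature_tensor scale T"
  shows "2 * T u x y z = (\<Sum>(c, d)\<in>Basis \<times> Basis. T u x c d *
    (representation Basis y c * representation Basis z d -
     representation Basis z c * representation Basis y d))"
proof -
  have expand: "T u x v w = (\<Sum>(c, d)\<in>Basis \<times> Basis.
      T u x c d * (representation Basis v c * representation Basis w d))" for v w
  proof -
    have lin: "Vector_Spaces.linear scale (*) (\<lambda>v. T u x v w)"
        "Vector_Spaces.linear scale (*) (\<lambda>w. T u x v w)" for v w
      using assms unfolding algebraic_curvature_tensor_def tensor4_def by blast+
    have "T u x v w = (\<Sum>c\<in>Basis. representation Basis v c * T u x c w)"
      by (rule linear_eq_sum_representation[OF lin(1)])
    also have "\<dots> = (\<Sum>c\<in>Basis. representation Basis v c *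
        (\<Sum>d\<in>Basis. representation Basis w d * T u x c d))"
      by (simp only: linear_eq_sum_representation[OF lin(2), of _ w, symmetric])
    finally show ?thesis
      by (simp add: sum.cartesian_product[symmetric] sum_distrib_left mult_ac)
  qed
  have "T u x y z = - T u x z y"
    using assms unfolding algebraic_curvature_tensor_def by blast
  then have "2 * T u x y z = T u x y z - T u x z y" by simp
  also have "\<dots> = (\<Sum>(c, d)\<in>Basis \<times> Basis. T u x c d *
    (representation Basis y c * representation Basis z d -
     representation Basis z c * representation Basis y d))"
    unfolding expand[of y z] expand[of z y]
    by (simp add: sum_subtractf[symmetric] case_prod_unfold right_diff_distrib)
  finally show ?thesis .
qed

end

text \<open>
  The witness comes from \<open>(F/8 + E) \<otimes> (F/8 + E) - (F/8 - E) \<otimes> (F/8 - E) = 1/4 (F \<otimes> E + E \<otimes> F)\<close>.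
  The two sides of each product may be rescaled against each other, so the factor 1/8 can be
  absorbed into \<open>F\<close> and the coefficients of the squares are mere signs.
\<close>
lemma curvature_tensor_eq_signed_sum_alpha:
  fixes scale :: "'k::field_char_0 \<Rightarrow> 'v::ab_group_add \<Rightarrow> 'v"
  assumes "finite_dimensional_vector_space scale B" "algebraic_curvature_tensor scale T"
  obtains A :: "('v \<times> 'v) \<Rightarrow> 'k \<Rightarrow> 'v \<Rightarrow> 'v \<Rightarrow> 'k"
  where "\<And>p s. alternating_tensor scale (A p s)"
    and "\<And>u x y z. T u x y z = (\<Sum>(p, s)\<in>(B \<times> B) \<times> {1, -1}. s * alpha_tensor (A p s) u x y z)"
proof
  interpret finite_dimensional_vector_space scale B by fact
  note vs = vector_space_axioms
  have T: "tensor4 scale T" "T u x y z = - T u x z y" "T u x y z = T y z u x"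
    "T u x y z + T u y z x + T u z x y = 0" for u x y z
    using assms(2) unfolding algebraic_curvature_tensor_def by blast+
  define F where "F p = (\<lambda>x y. T x y (fst p) (snd p))" for p
  define E where "E p = (\<lambda>x y. representation B x (fst p) * representation B y (snd p) -
    representation B y (fst p) * representation B x (snd p))" for p
  define A where "A p s = (\<lambda>x y. 1/8 * F p x y + s * E p x y)" for p s
  have F: "alternating_tensor scale (F p)" for p
    unfolding F_def alternating_tensor_def tensor2_def
    using T(1) T(2,3) unfolding tensor4_def by metis
  have E: "alternating_tensor scale (E p)" for p
    unfolding E_def by (intro alternating_tensor_wedge linear_representation)
  show A: "alternating_tensor scale (A p s)" for p s
    unfolding A_def by (intro alternating_tensor_add alternating_tensor_scale vs F E)
  have squares: "T u x y z = (\<Sum>p\<in>B \<times> B. A p 1 u x * A p 1 y z - A p (-1) u x * A p (-1) y z)"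
    for u x y z
  proof -
    have half: "2 * T u x y z = (\<Sum>p\<in>B \<times> B. F p u x * E p y z)" for u x y z
      unfolding F_def E_def using curvature_tensor_expansion[OF assms(2), of u x y z]
      by (simp add: case_prod_unfold)
    have "4 * T u x y z = 2 * T u x y z + 2 * T y z u x"
      using T(3)[of u x y z] by simp
    also have "\<dots> = (\<Sum>p\<in>B \<times> B. F p u x * E p y z + F p y z * E p u x)"
      by (simp only: half sum.distrib)
    also have "\<dots> = (\<Sum>p\<in>B \<times> B. 4 * (A p 1 u x * A p 1 y z - A p (-1) u x * A p (-1) y z))"
      by (intro sum.cong refl) (simp add: A_def field_simps)
    finally have "4 * T u x y z =
        4 * (\<Sum>p\<in>B \<times> B. A p 1 u x * A p 1 y z - A p (-1) u x * A p (-1) y z)"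
      by (simp only: sum_distrib_left)
    then show ?thesis by simp
  qed
  show "T u x y z = (\<Sum>(p, s)\<in>(B \<times> B) \<times> {1, -1}. s * alpha_tensor (A p s) u x y z)" for u x y z
  proof -
    have anti: "A p s y x = - A p s x y" for p s x y
      using A unfolding alternating_tensor_def by blast
    have "T u x y z = 1/3 * (2 * T u x y z - T u y z x - T u z x y)"
      using T(4)[of u x y z] by (simp add: algebra_simps eq_neg_iff_add_eq_0)
    also have "\<dots> = (\<Sum>p\<in>B \<times> B. alpha_tensor (A p 1) u x y z - alpha_tensor (A p (-1)) u x y z)"
      unfolding squares[of u x y z] squares[of u y z x] squares[of u z x y]
        alpha_tensor_eq_Bianchi_projection[OF anti] sum_distrib_left sum_subtractf[symmetric]
      by (intro sum.cong refl) (simp add: algebra_simps)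
    finally show ?thesis
      by (simp add: sum.cartesian_product[symmetric])
  qed
qed

text \<open>
  The root \<open>r\<close> of 2 turns a doubled term \<open>2\<alpha>(A)\<close> into \<open>\<alpha>(r A)\<close>, which is what merging
  repeated tensors requires.
\<close>
lemma curvature_tensor_decomposition:
  fixes scale :: "'k::field_char_0 \<Rightarrow> 'v::ab_group_add \<Rightarrow> 'v" and r :: 'k
  assumes "finite_dimensional_vector_space scale B" "algebraic_curvature_tensor scale T"
    and r: "r^2 = 2"
  shows "\<exists>\<S> \<A> (\<epsilon>\<^sub>S :: ('v \<Rightarrow> 'v \<Rightarrow> 'k) \<Rightarrow> 'k) (\<epsilon>\<^sub>A :: ('v \<Rightarrow> 'v \<Rightarrow> 'k) \<Rightarrow> 'k).
    finite \<S> \<and> (\<forall>S\<in>\<S>. symmetric_tensor scale S \<and> \<epsilon>\<^sub>S S \<in> {1, -1}) \<and>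
    finite \<A> \<and> (\<forall>A\<in>\<A>. alternating_tensor scale A \<and> \<epsilon>\<^sub>A A \<in> {1, -1}) \<and>
    (\<forall>u x y z. T u x y z =
       (\<Sum>S\<in>\<S>. \<epsilon>\<^sub>S S * gamma_tensor S u x y z) +
       (\<Sum>A\<in>\<A>. \<epsilon>\<^sub>A A * alpha_tensor A u x y z))"
proof -
  interpret finite_dimensional_vector_space scale B by fact
  let ?C = "{A. alternating_tensor scale A}"
  let ?I = "(B \<times> B) \<times> {1, -1 :: 'k}"
  define q where "q = (\<lambda>A :: 'v \<Rightarrow> 'v \<Rightarrow> 'k. \<lambda>(u, x, y, z). alpha_tensor A u x y z)"
  obtain A :: "('v \<times> 'v) \<Rightarrow> 'k \<Rightarrow> 'v \<Rightarrow> 'v \<Rightarrow> 'k"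
    where A: "\<And>p s. alternating_tensor scale (A p s)"
      "\<And>u x y z. T u x y z = (\<Sum>(p, s)\<in>?I. s * alpha_tensor (A p s) u x y z)"
    using curvature_tensor_eq_signed_sum_alpha[OF assms(1,2)] by blast
  have double: "\<exists>b\<in>?C. \<forall>t. q b t = 2 * q a t" if "a \<in> ?C" for a
    using that r alternating_tensor_scale[OF vector_space_axioms, of a r]
    by (intro bexI[of _ "\<lambda>x y. r * a x y"]) (auto simp: q_def alpha_tensor_scale)
  have "\<exists>X \<epsilon>. finite X \<and> X \<subseteq> ?C \<and> (\<forall>x\<in>X. \<epsilon> x \<in> {1, -1}) \<and>
           (\<forall>t. (\<Sum>x\<in>X. \<epsilon> x * q x t) = (\<Sum>i\<in>?I. snd i * q (A (fst i) (snd i)) t))"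
    by (rule signed_sum_over_set[OF double]) (use A(1) finite_Basis in auto)
  then obtain X \<epsilon> where X: "finite X" "X \<subseteq> ?C" "\<forall>x\<in>X. \<epsilon> x \<in> {1, -1}"
    "\<And>t. (\<Sum>x\<in>X. \<epsilon> x * q x t) = (\<Sum>i\<in>?I. snd i * q (A (fst i) (snd i)) t)"
    by blast
  have "T u x y z = (\<Sum>A\<in>X. \<epsilon> A * alpha_tensor A u x y z)" for u x y z
    using X(4)[of "(u, x, y, z)"] unfolding A(2) q_def by (simp add: case_prod_unfold)
  with X(1-3) show ?thesis
    by (intro exI[of _ "{}"] exI[of _ X] exI[of _ "\<lambda>_. 1"] exI[of _ \<epsilon>]) auto
qed

theorem theorem3p1:
  fixes scaleV :: "real \<Rightarrow> 'v::ab_group_add \<Rightarrow> 'v"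
    and scaleW :: "complex \<Rightarrow> 'w::ab_group_add \<Rightarrow> 'w"
  shows "((\<exists>B. finite_dimensional_vector_space scaleV B) \<longrightarrow>
          (\<forall>T. algebraic_curvature_tensor scaleV T \<longrightarrow>
             (\<exists>\<S> \<A> (\<epsilon>\<^sub>S :: ('v \<Rightarrow> 'v \<Rightarrow> real) \<Rightarrow> real) (\<epsilon>\<^sub>A :: ('v \<Rightarrow> 'v \<Rightarrow> real) \<Rightarrow> real).
                finite \<S> \<and> (\<forall>S\<in>\<S>. symmetric_tensor scaleV S \<and> \<epsilon>\<^sub>S S \<in> {1, -1}) \<and>
                finite \<A> \<and> (\<forall>A\<in>\<A>. alternating_tensor scaleV A \<and> \<epsilon>\<^sub>A A \<in> {1, -1}) \<and>
                (\<forall>u x y z. T u x y z =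
                   (\<Sum>S\<in>\<S>. \<epsilon>\<^sub>S S * gamma_tensor S u x y z) +
                   (\<Sum>A\<in>\<A>. \<epsilon>\<^sub>A A * alpha_tensor A u x y z))))) \<and>
         ((\<exists>B. finite_dimensional_vector_space scaleW B) \<longrightarrow>
          (\<forall>T. algebraic_curvature_tensor scaleW T \<longrightarrow>
             (\<exists>\<S> \<A> (\<epsilon>\<^sub>S :: ('w \<Rightarrow> 'w \<Rightarrow> complex) \<Rightarrow> complex) (\<epsilon>\<^sub>A :: ('w \<Rightarrow> 'w \<Rightarrow> complex) \<Rightarrow> complex).
                finite \<S> \<and> (\<forall>S\<in>\<S>. symmetric_tensor scaleW S \<and> \<epsilon>\<^sub>S S \<in> {1, -1}) \<and>
                finite \<A> \<and> (\<forall>A\<in>\<A>. alternating_tensor scaleW A \<and> \<epsilon>\<^sub>A A \<in> {1, -1}) \<and>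
                (\<forall>u x y z. T u x y z =
                   (\<Sum>S\<in>\<S>. \<epsilon>\<^sub>S S * gamma_tensor S u x y z) +
                   (\<Sum>A\<in>\<A>. \<epsilon>\<^sub>A A * alpha_tensor A u x y z)))))"
proof -
  have r: "(sqrt 2)\<^sup>2 = (2::real)" and c: "(complex_of_real (sqrt 2))\<^sup>2 = 2"
    by (simp_all flip: of_real_power)
  show ?thesis
    using curvature_tensor_decomposition[OF _ _ r] curvature_tensor_decomposition[OF _ _ c]
    by (intro conjI impI allI; elim exE)
qed

end
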